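(* Let $\mathrm{Irr}_{\mathrm{diff}}(1)=\{(a,b,\mathbb C):\ a,b\in\mathbb C,\ |a|^2+|b|^2=1,\ a\neq0\neq b\}$. The set $\mathrm{Irr}_{\mathrm{diff}}(1)$ equipped with the tensor product $\boxtimes$ forms an abelian Lie group with identity $\mathbf 1=(1/\sqrt2,1/\sqrt2,\mathbb C)$ and inverse $$(a,b,\mathbb C)^{-1}=(|b|e^{-i\mathrm{Arg}(a)},|a|e^{-i\mathrm{Arg}(b)},\mathbb C)$$ where $\mathrm{Arg}$ is any argument function. Moreover, there is an isomorphism of Lie groups $$S_1\times S_1\times\mathbb R\to\mathrm{Irr}_{\mathrm{diff}}(1),\quad(u,v,t)\mapsto\Big(\frac{u}{\sqrt{e^t+1}},\ \sqrt{\frac{e^t}{e^t+1}}\,v,\ \mathbb C\Big).$$ Hence $(\mathrm{Irr}_{\mathrm{diff}}(1),\boxtimes)$ is a connected abelian Lie group of dimension $3$.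
   Context: $S_1$ is the unit circle in $\mathbb C$ (under multiplication) and $\mathbb R$ is taken with addition. A P-module is a triple $(A,B,\mathfrak H)$ with $A,B$ bounded operators on a (here finite-dimensional) complex Hilbert space $\mathfrak H$ with $A^*A+B^*B=\mathrm{id}$. When $\ker(A\otimes\tilde A)\cap\ker(B\otimes\tilde B)=\{0\}$, the tensor product is $$(A,B,\mathfrak H)\boxtimes(\tilde A,\tilde B,\tilde{\mathfrak H}):=((A\otimes\tilde A)K^{-1},(B\otimes\tilde B)K^{-1},\mathfrak H\otimes\tilde{\mathfrak H}),\quad K:=\sqrt{|A|^2\otimes|\tilde A|^2+|B|^2\otimes|\tilde B|^2}.$$ For one-dimensional P-modules, identifying $\mathbb C\otimes\mathbb C$ with $\mathbb C$, this reads $(a,b,\mathbb C)\boxtimes(\tilde a,\tilde b,\mathbb C)=(a\tilde a/k,\,b\tilde b/k,\,\mathbb C)$ with $k=\sqrt{|a\tilde a|^2+|b\tilde b|^2}$. The smooth structure on $\mathrm{Irr}_{\mathrm{diff}}(1)$ is that of an open subset of the unit sphere of $\mathbb C^2$. *)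

theory Defs
  imports "HOL-Analysis.Analysis" "HOL-Algebra.Group"
begin

section \<open>Smooth maps and submanifolds of Euclidean spaces\<close>

text \<open>Meaningful for open \<open>U\<close>. In finite dimension, continuity of the derivative is
  continuity of all its directional values, so \<open>C_on k U f\<close> is the usual \<open>C\<^sup>k\<close> condition.\<close>

primrec C_on :: "nat \<Rightarrow> 'a::euclidean_space set \<Rightarrow> ('a \<Rightarrow> 'b::euclidean_space) \<Rightarrow> bool" where
  "C_on 0 U f \<longleftrightarrow> continuous_on U f"
| "C_on (Suc k) U f \<longleftrightarrow>
     (\<forall>x\<in>U. f differentiable (at x)) \<and> (\<forall>v. C_on k U (\<lambda>x. frechet_derivative f (at x) v))"

text \<open>Smoothness on an arbitrary subset of a Euclidean space: local extendability to a smooth map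
  on an open set of the ambient space. On an embedded submanifold this is smoothness with
  respect to the induced structure.\<close>

definition smooth_map_on :: "'a::euclidean_space set \<Rightarrow> ('a \<Rightarrow> 'b::euclidean_space) \<Rightarrow> bool" where
  "smooth_map_on X f \<longleftrightarrow>
     (\<forall>x\<in>X. \<exists>U g. open U \<and> x \<in> U \<and> (\<forall>k. C_on k U g) \<and> (\<forall>y\<in>U \<inter> X. g y = f y))"

definition diffeomorphism ::
  "'a::euclidean_space set \<Rightarrow> 'b::euclidean_space set \<Rightarrow> ('a \<Rightarrow> 'b) \<Rightarrow> ('b \<Rightarrow> 'a) \<Rightarrow> bool" where
  "diffeomorphism X Y f g \<longleftrightarrow>
     smooth_map_on X f \<and> f ` X = Y \<and> smooth_map_on Y g \<and> g ` Y = X \<and>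
     (\<forall>x\<in>X. g (f x) = x) \<and> (\<forall>y\<in>Y. f (g y) = y)"

text \<open>Smooth submanifolds of a Euclidean space, modelled on \<open>'e\<close>; the dimension is \<open>DIM('e)\<close>.\<close>

definition smooth_submanifold :: "'e::euclidean_space itself \<Rightarrow> 'a::euclidean_space set \<Rightarrow> bool" where
  "smooth_submanifold _ M \<longleftrightarrow>
     (\<forall>x\<in>M. \<exists>V (U :: 'e set) \<phi> \<psi>.
        openin (top_of_set M) V \<and> x \<in> V \<and> open U \<and> diffeomorphism V U \<phi> \<psi>)"

section \<open>Lie groups\<close>

definition lie_group :: "'e::euclidean_space itself \<Rightarrow> 'a::euclidean_space monoid \<Rightarrow> bool" where
  "lie_group E G \<longleftrightarrow>
     group G \<and> smooth_submanifold E (carrier G) \<and>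
     smooth_map_on (carrier G \<times> carrier G) (\<lambda>(x, y). x \<otimes>\<^bsub>G\<^esub> y) \<and>
     smooth_map_on (carrier G) (\<lambda>x. inv\<^bsub>G\<^esub> x)"

definition lie_group_iso ::
  "'a::euclidean_space monoid \<Rightarrow> 'b::euclidean_space monoid \<Rightarrow> ('a \<Rightarrow> 'b) \<Rightarrow> bool" where
  "lie_group_iso G H f \<longleftrightarrow> f \<in> iso G H \<and> (\<exists>g. diffeomorphism (carrier G) (carrier H) f g)"

definition circle_group :: "complex monoid" where
  "circle_group = \<lparr>carrier = sphere 0 1, monoid.mult = (*), one = 1\<rparr>"

definition real_add_group :: "real monoid" where
  "real_add_group = \<lparr>carrier = UNIV, monoid.mult = (+), one = 0\<rparr>"

section \<open>P-modules and their tensor product\<close>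

text \<open>A P-module \<open>(A, B, \<complex>\<^sup>n)\<close> is represented by the pair of matrices of \<open>A\<close> and \<open>B\<close>.
  The space \<open>\<complex>\<^sup>m \<otimes> \<complex>\<^sup>n\<close> is \<open>\<complex>\<^sup>m\<^sup>n\<close>, with coordinates indexed by pairs.\<close>

type_synonym 'n pmod = "(complex^'n^'n) \<times> (complex^'n^'n)"

definition adjoint_mat :: "complex^'n^'n \<Rightarrow> complex^'n^'n" where
  "adjoint_mat A = (\<chi> i j. cnj (A $ j $ i))"

definition P_module :: "'n::finite pmod \<Rightarrow> bool" where
  "P_module = (\<lambda>(A, B). adjoint_mat A ** A + adjoint_mat B ** B = mat 1)"

definition kron :: "complex^'m^'m \<Rightarrow> complex^'n^'n \<Rightarrow> complex^('m \<times> 'n)^('m \<times> 'n)" where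
  "kron A B = (\<chi> i j. A $ fst i $ fst j * B $ snd i $ snd j)"

text \<open>\<open>\<bullet>\<close> is the real part of the Hermitian inner product, and \<open>\<langle>x, S x\<rangle>\<close> is real for
  self-adjoint \<open>S\<close>.\<close>

definition pos_sqrt :: "complex^'n^'n \<Rightarrow> complex^'n^'n" where
  "pos_sqrt M = (THE S. adjoint_mat S = S \<and> (\<forall>x. 0 \<le> x \<bullet> (S *v x)) \<and> S ** S = M)"

definition tensor_defined :: "'m::finite pmod \<Rightarrow> 'n::finite pmod \<Rightarrow> bool" where
  "tensor_defined = (\<lambda>(A, B) (A', B').
     {x. kron A A' *v x = 0} \<inter> {x. kron B B' *v x = 0} = {0})"

text \<open>Only meaningful when \<open>tensor_defined\<close> holds; \<open>K\<close> is then invertible.\<close>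

definition pmod_tensor :: "'m::finite pmod \<Rightarrow> 'n::finite pmod \<Rightarrow> ('m \<times> 'n) pmod" where
  "pmod_tensor = (\<lambda>(A, B) (A', B').
     let K = pos_sqrt (kron (adjoint_mat A ** A) (adjoint_mat A' ** A') +
                       kron (adjoint_mat B ** B) (adjoint_mat B' ** B'))
     in (kron A A' ** matrix_inv K, kron B B' ** matrix_inv K))"

section \<open>One-dimensional P-modules\<close>

text \<open>The pair \<open>(a, b)\<close> stands for the triple \<open>(a, b, \<complex>)\<close>.\<close>

definition scalar_pmod :: "complex \<times> complex \<Rightarrow> 1 pmod" where
  "scalar_pmod = (\<lambda>(a, b). (mat a, mat b))"

text \<open>The tensor product under the identification \<open>\<complex> \<otimes> \<complex> = \<complex>\<close>: an operator on \<open>\<complex> \<otimes> \<complex>\<close> is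
  identified with its single matrix entry. See \<open>tensor1_formula\<close>.\<close>

definition tensor1 :: "complex \<times> complex \<Rightarrow> complex \<times> complex \<Rightarrow> complex \<times> complex" where
  "tensor1 p q = (case pmod_tensor (scalar_pmod p) (scalar_pmod q) of
     (A, B) \<Rightarrow> (A $ (1, 1) $ (1, 1), B $ (1, 1) $ (1, 1)))"

definition Irr_diff1 :: "(complex \<times> complex) set" where
  "Irr_diff1 = {(a, b). (cmod a)\<^sup>2 + (cmod b)\<^sup>2 = 1 \<and> a \<noteq> 0 \<and> b \<noteq> 0}"

definition Irr_diff1_group :: "(complex \<times> complex) monoid" where
  "Irr_diff1_group = \<lparr>carrier = Irr_diff1, monoid.mult = tensor1,
     one = (of_real (1 / sqrt 2), of_real (1 / sqrt 2))\<rparr>"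

text \<open>The smooth structure on \<open>Irr_diff1\<close> as a subset of \<open>\<complex>\<^sup>2\<close> is the one induced from the sphere.\<close>

lemma openin_Irr_diff1: "openin (top_of_set (sphere 0 1)) Irr_diff1"
proof -
  have "Irr_diff1 = sphere 0 1 \<inter> ((UNIV - {0}) \<times> (UNIV - {0}))"
    by (auto simp: Irr_diff1_def norm_prod_def)
  moreover have "open ((UNIV - {0 :: complex}) \<times> (UNIV - {0 :: complex}))"
    by (intro open_Times open_delete open_UNIV)
  ultimately show ?thesis by (metis openin_open_Int)
qed

lemma matrix_eq_mat_entry: "(M :: complex^(1 \<times> 1)^(1 \<times> 1)) = mat (M $ (1, 1) $ (1, 1))"
  by (simp add: vec_eq_iff mat_def split_paired_all)

lemma P_module_scalar:
  "P_module (scalar_pmod (a, b)) \<longleftrightarrow> (cmod a)\<^sup>2 + (cmod b)\<^sup>2 = 1"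
proof -
  have "P_module (scalar_pmod (a, b)) \<longleftrightarrow> cnj a * a + cnj b * b = 1"
    by (simp add: P_module_def scalar_pmod_def adjoint_mat_def mat_def matrix_matrix_mult_def
        vec_eq_iff)
  also have "cnj a * a + cnj b * b = of_real ((cmod a)\<^sup>2 + (cmod b)\<^sup>2)"
    by (simp add: complex_norm_square[symmetric] mult.commute)
  finally show ?thesis by (metis of_real_eq_1_iff)
qed

lemma sum_num1_pair: "(\<Sum>i\<in>UNIV. f i) = f (1 :: 1, 1 :: 1)"
proof -
  have "(UNIV :: (1 \<times> 1) set) = {(1, 1)}" by auto
  then have "sum f UNIV = sum f {(1, 1)}" by (rule arg_cong)
  then show ?thesis by simp
qed

lemma mat_num1_mult:
  "(mat c :: complex^(1 \<times> 1)^(1 \<times> 1)) ** mat d = mat (c * d)"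
  by (simp add: vec_eq_iff mat_def matrix_matrix_mult_def sum_num1_pair split_paired_all)

lemma mat_num1_vec:
  "(mat c :: complex^(1 \<times> 1)^(1 \<times> 1)) *v x = c *s x"
  by (simp add: vec_eq_iff mat_def matrix_vector_mult_def sum_num1_pair split_paired_all)

lemma pos_sqrt_scalar:
  assumes "0 \<le> r"
  shows "pos_sqrt (mat (of_real r) :: complex^(1 \<times> 1)^(1 \<times> 1)) = mat (of_real (sqrt r))"
  unfolding pos_sqrt_def
proof (rule the_equality, intro conjI allI)
  show "adjoint_mat (mat (of_real (sqrt r))) = (mat (of_real (sqrt r)) :: complex^(1 \<times> 1)^(1 \<times> 1))"
    by (simp add: adjoint_mat_def mat_def vec_eq_iff)
  show "0 \<le> x \<bullet> (mat (of_real (sqrt r)) *v x)" for x :: "complex^(1 \<times> 1)"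
  proof -
    have "x \<bullet> (mat (of_real (sqrt r)) *v x) = sqrt r * (x \<bullet> x)"
      by (simp add: mat_num1_vec inner_vec_def sum_num1_pair inner_complex_def algebra_simps)
    then show ?thesis using assms by simp
  qed
  show "(mat (of_real (sqrt r)) :: complex^(1 \<times> 1)^(1 \<times> 1)) ** mat (of_real (sqrt r)) = mat (of_real r)"
    using assms by (simp add: mat_num1_mult of_real_mult[symmetric] del: of_real_mult)
next
  fix S :: "complex^(1 \<times> 1)^(1 \<times> 1)"
  assume S: "adjoint_mat S = S \<and> (\<forall>x. 0 \<le> x \<bullet> (S *v x)) \<and> S ** S = mat (of_real r)"
  define s where "s = S $ (1, 1) $ (1, 1)"
  have "adjoint_mat S $ (1, 1) $ (1, 1) = S $ (1, 1) $ (1, 1)" using S by simp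
  then have "cnj s = s" by (simp add: s_def adjoint_mat_def)
  then have im: "Im s = 0" by (simp add: complex_eq_iff)
  have "0 \<le> (\<chi> i. 1) \<bullet> (S *v (\<chi> i. 1))" using S by blast
  then have re: "0 \<le> Re s"
    by (simp add: s_def inner_vec_def matrix_vector_mult_def sum_num1_pair inner_complex_def)
  have "(S ** S) $ (1, 1) $ (1, 1) = of_real r" using S by (simp add: mat_def)
  then have "s * s = of_real r"
    by (simp add: s_def matrix_matrix_mult_def sum_num1_pair)
  then have "Re s * Re s = r" using im by (simp add: complex_eq_iff)
  then have "Re s = sqrt r" using re real_sqrt_abs2[of "Re s"] by simp
  then have "s = of_real (sqrt r)" using im by (simp add: complex_eq_iff)
  then show "S = mat (of_real (sqrt r))" using matrix_eq_mat_entry[of S] s_def by simp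
qed

lemma tensor_defined_scalar:
  "tensor_defined (scalar_pmod (a, b)) (scalar_pmod (a', b')) \<longleftrightarrow> a * a' \<noteq> 0 \<or> b * b' \<noteq> 0"
proof -
  have *: "kron (mat c) (mat d) *v x = (c * d) *s x" for c d and x :: "complex^(1 \<times> 1)"
    by (simp add: vec_eq_iff kron_def mat_def matrix_vector_mult_def sum_num1_pair)
  have "(1 :: complex^(1 \<times> 1)) \<noteq> 0" by simp
  then show ?thesis
    unfolding tensor_defined_def scalar_pmod_def
    by (auto simp: *)
qed

lemma tensor1_formula:
  fixes a b a' b' :: complex
  defines "k \<equiv> sqrt ((cmod (a * a'))\<^sup>2 + (cmod (b * b'))\<^sup>2)"
  assumes "a * a' \<noteq> 0 \<or> b * b' \<noteq> 0"
  shows "tensor1 (a, b) (a', b') = (a * a' / of_real k, b * b' / of_real k)"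
proof -
  have k0: "k \<noteq> 0" using assms by (auto simp: k_def add_nonneg_eq_0_iff)
  have sq: "cnj z * z = of_real ((cmod z)\<^sup>2)" for z
    using complex_norm_square[of z] by (simp add: mult.commute)
  have "kron (adjoint_mat (mat a) ** mat a) (adjoint_mat (mat a') ** mat a') +
        kron (adjoint_mat (mat b) ** mat b) (adjoint_mat (mat b') ** mat b') =
        (mat (of_real (k\<^sup>2)) :: complex^(1 \<times> 1)^(1 \<times> 1))"
    by (simp add: vec_eq_iff kron_def adjoint_mat_def mat_def matrix_matrix_mult_def sq k_def
        norm_mult power_mult_distrib split_paired_all del: of_real_power)
  then have K: "pos_sqrt (kron (adjoint_mat (mat a) ** mat a) (adjoint_mat (mat a') ** mat a') +
        kron (adjoint_mat (mat b) ** mat b) (adjoint_mat (mat b') ** mat b')) =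
        (mat (of_real k) :: complex^(1 \<times> 1)^(1 \<times> 1))"
    using pos_sqrt_scalar[of "k\<^sup>2"] by (simp add: k_def)
  have inv: "matrix_inv (mat (of_real k) :: complex^(1 \<times> 1)^(1 \<times> 1)) = mat (inverse (of_real k))"
  proof -
    let ?K = "mat (of_real k) :: complex^(1 \<times> 1)^(1 \<times> 1)"
    have 1: "?K ** mat (inverse (of_real k)) = mat 1" "mat (inverse (of_real k)) ** ?K = mat 1"
      using k0 by (simp_all add: mat_num1_mult)
    then have "?K ** matrix_inv ?K = mat 1"
      unfolding matrix_inv_def by (rule_tac someI2[of _ "mat (inverse (of_real k))"]) auto
    then show ?thesis using 1 by (metis matrix_mul_assoc matrix_mul_lid matrix_mul_rid)
  qed
  show ?thesis
    unfolding tensor1_def pmod_tensor_def scalar_pmod_def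
    by (simp add: K inv Let_def) (simp add: kron_def mat_def matrix_matrix_mult_def sum_num1_pair divide_inverse)
qed

end

theory Submission
  imports Defs
begin

text \<open>The map \<open>(u, v, t) \<mapsto> (u / sqrt (e\<^sup>t + 1), sqrt (e\<^sup>t / (e\<^sup>t + 1)) v)\<close> does all the work. A pair
  \<open>(a, b)\<close> of nonzero numbers with \<open>\<bar>a\<bar>\<^sup>2 + \<bar>b\<bar>\<^sup>2 = 1\<close> is determined by the phases of \<open>a\<close> and \<open>b\<close> and by
  the ratio \<open>\<bar>b\<bar>\<^sup>2 / \<bar>a\<bar>\<^sup>2\<close>, which can be any positive number \<open>e\<^sup>t\<close>. The tensor product multiplies both
  entries and then rescales them by a common positive factor: phases and ratios are multiplied, so
  the exponents \<open>t\<close> add up. The map is therefore a bijection from the product of two circles and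
  the real line that respects the operations (\<open>param_mult\<close>), and the group axioms on the target
  follow from those on the source.

  Both the map and its inverse \<open>(a, b) \<mapsto> (a / \<bar>a\<bar>, b / \<bar>b\<bar>, ln \<bar>b\<bar>\<^sup>2 - ln \<bar>a\<bar>\<^sup>2)\<close> are restrictions of
  smooth maps on open sets (\<open>diffeomorphism_param\<close>). So the source and the target are Lie groups
  together (\<open>lie_group_transfer\<close>), and it suffices to know that the circle and the line are
  one-dimensional Lie groups and that products of Lie groups are Lie groups, with dimensions adding
  up. Connectedness passes from the source to the target, and the formula for the inverse
  is checked by multiplying out.

  Underneath lies a calculus of \<open>C\<^sup>k\<close> maps: bilinear operations, composition and the elementary
  functions preserve \<open>C\<^sup>k\<close>, which induction on \<open>k\<close> derives from the rules of differentiation.\<close>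

section \<open>Calculus of \<open>C\<^sup>k\<close> maps\<close>

lemma C_on_cong:
  assumes "open U" "\<And>x. x \<in> U \<Longrightarrow> f x = g x"
  shows "C_on k U f \<longleftrightarrow> C_on k U g"
  using assms(2)
proof (induction k arbitrary: f g)
  case 0
  then show ?case by (simp cong: continuous_on_cong)
next
  case (Suc k)
  have eq: "(f has_derivative D) (at x) \<longleftrightarrow> (g has_derivative D) (at x)" if "x \<in> U" for x D
    using that Suc.prems assms(1) has_derivative_transform_within_open[of f D x UNIV U g]
      has_derivative_transform_within_open[of g D x UNIV U f] by auto
  have "frechet_derivative f (at x) = frechet_derivative g (at x)" if "x \<in> U" for x
    using eq[OF that] by (simp add: frechet_derivative_def)
  then have "C_on k U (\<lambda>x. frechet_derivative f (at x) v) \<longleftrightarrow>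
      C_on k U (\<lambda>x. frechet_derivative g (at x) v)" for v
    by (intro Suc.IH) simp
  then show ?case using eq by (simp add: differentiable_def)
qed

text \<open>The definition speaks of the chosen derivative of each map, at every level of differentiation.
  Derivatives are unique and depend only on the values nearby, so on an open set any
  explicit formula for the derivative serves as well.\<close>

lemma C_on_SucI:
  assumes "open U" "\<And>x. x \<in> U \<Longrightarrow> (f has_derivative D x) (at x)"
    "\<And>v. C_on k U (\<lambda>x. D x v)"
  shows "C_on (Suc k) U f"
proof -
  have "frechet_derivative f (at x) = D x" if "x \<in> U" for x
    using assms(2)[OF that] by (rule frechet_derivative_at[symmetric])
  then have "C_on k U (\<lambda>x. frechet_derivative f (at x) v)" for v
    using assms(1,3) C_on_cong[of U "\<lambda>x. frechet_derivative f (at x) v" "\<lambda>x. D x v"] by auto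
  then show ?thesis using assms(2) by (auto simp: differentiable_def)
qed

lemma C_on_SucE:
  assumes "C_on (Suc k) U f"
  obtains D where "\<forall>x\<in>U. (f has_derivative D x) (at x)" "\<forall>v. C_on k U (\<lambda>x. D x v)"
  using assms that[of "\<lambda>x. frechet_derivative f (at x)"] by (auto simp: frechet_derivative_works)

lemma C_on_Suc_imp:
  assumes "open U"
  shows "C_on (Suc k) U f \<Longrightarrow> C_on k U f"
proof (induction k arbitrary: f)
  case 0
  then show ?case
    by (auto intro!: continuous_at_imp_continuous_on differentiable_imp_continuous_within)
next
  case (Suc k)
  from Suc.prems obtain D where D: "\<forall>x\<in>U. (f has_derivative D x) (at x)"
    "\<forall>v. C_on (Suc k) U (\<lambda>x. D x v)" by (rule C_on_SucE)
  then show ?case by (intro C_on_SucI[OF assms, of f D] Suc.IH) auto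
qed

lemma C_on_imp_continuous_on:
  assumes "open U"
  shows "C_on k U f \<Longrightarrow> continuous_on U f"
proof (induction k)
  case (Suc k)
  then show ?case using C_on_Suc_imp[OF assms] by blast
qed simp

lemma C_on_subset: "C_on k U f \<Longrightarrow> V \<subseteq> U \<Longrightarrow> C_on k V f"
  by (induction k arbitrary: f) (auto intro: continuous_on_subset)

lemma C_on_const: "open U \<Longrightarrow> C_on k U (\<lambda>x. c)"
proof (induction k arbitrary: c)
  case (Suc k)
  then show ?case by (intro C_on_SucI[where D = "\<lambda>x v. 0"] has_derivative_const)
qed simp

lemma C_on_linear:
  assumes "open U" "bounded_linear L"
  shows "C_on k U L"
proof (cases k)
  case 0
  then show ?thesis using assms by (simp add: linear_continuous_on)
next
  case (Suc m)
  show ?thesis unfolding Suc using assms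
    by (intro C_on_SucI[where D = "\<lambda>x. L"] C_on_const bounded_linear_imp_has_derivative)
qed

lemma C_on_add:
  assumes "open U" "C_on k U f" "C_on k U g"
  shows "C_on k U (\<lambda>x. f x + g x)"
  using assms(2,3)
proof (induction k arbitrary: f g)
  case 0
  then show ?case by (auto intro: continuous_on_add)
next
  case (Suc k)
  from Suc.prems(1) obtain F where F: "\<forall>x\<in>U. (f has_derivative F x) (at x)"
    "\<forall>v. C_on k U (\<lambda>x. F x v)" by (rule C_on_SucE)
  from Suc.prems(2) obtain G where G: "\<forall>x\<in>U. (g has_derivative G x) (at x)"
    "\<forall>v. C_on k U (\<lambda>x. G x v)" by (rule C_on_SucE)
  show ?case
    by (rule C_on_SucI[where D = "\<lambda>x v. F x v + G x v"])
      (use F G assms(1) in \<open>auto intro: has_derivative_add Suc.IH\<close>)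
qed

lemma C_on_sum:
  assumes "open U" "\<And>i. i \<in> I \<Longrightarrow> C_on k U (f i)"
  shows "C_on k U (\<lambda>x. \<Sum>i\<in>I. f i x)"
  using assms(2)
  by (induction I rule: infinite_finite_induct) (auto intro: C_on_const C_on_add assms(1))

text \<open>The Leibniz rule writes the derivative of a bilinear expression as a sum of two bilinear
  expressions in maps that are one degree less smooth.\<close>


lemma C_on_bilinear:
  assumes "bounded_bilinear h" "open U" "C_on k U f" "C_on k U g"
  shows "C_on k U (\<lambda>x. h (f x) (g x))"
  using assms(3,4)
proof (induction k arbitrary: f g)
  case 0
  then show ?case by (auto intro: bounded_bilinear.continuous_on[OF assms(1)])
next
  case (Suc k)
  from Suc.prems(1) obtain F where F: "\<forall>x\<in>U. (f has_derivative F x) (at x)"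
    "\<forall>v. C_on k U (\<lambda>x. F x v)" by (rule C_on_SucE)
  from Suc.prems(2) obtain G where G: "\<forall>x\<in>U. (g has_derivative G x) (at x)"
    "\<forall>v. C_on k U (\<lambda>x. G x v)" by (rule C_on_SucE)
  show ?case
    by (rule C_on_SucI[where D = "\<lambda>x v. h (f x) (G x v) + h (F x v) (g x)"])
      (use F G assms(2) Suc.prems[THEN C_on_Suc_imp[OF assms(2)]] in
        \<open>auto intro!: bounded_bilinear.FDERIV[OF assms(1)] C_on_add Suc.IH\<close>)
qed

lemmas C_on_mult = C_on_bilinear[OF bounded_bilinear_mult]
lemmas C_on_scaleR = C_on_bilinear[OF bounded_bilinear_scaleR]
lemmas C_on_inner = C_on_bilinear[OF bounded_bilinear_inner]

text \<open>Expanding the inner derivative in an orthonormal basis turns the chain rule into a finite sum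
  of products, so that the induction stays within statements about \<open>C\<^sup>k\<close> maps.\<close>

lemma C_on_compose:
  assumes "open U" "open V" "C_on k U f" "C_on k V g" "f ` U \<subseteq> V"
  shows "C_on k U (\<lambda>x. g (f x))"
  using assms(3,4)
proof (induction k arbitrary: g)
  case 0
  then show ?case using assms(5) by (auto intro: continuous_on_compose2)
next
  case (Suc k)
  from Suc.prems(1) obtain F where F: "\<forall>x\<in>U. (f has_derivative F x) (at x)"
    "\<forall>v. C_on k U (\<lambda>x. F x v)" by (rule C_on_SucE)
  from Suc.prems(2) obtain G where G: "\<forall>y\<in>V. (g has_derivative G y) (at y)"
    "\<forall>v. C_on k V (\<lambda>y. G y v)" by (rule C_on_SucE)
  have deriv: "((\<lambda>x. g (f x)) has_derivative (\<lambda>v. \<Sum>i\<in>Basis. (F x v \<bullet> i) *\<^sub>R G (f x) i)) (at x)"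
    if "x \<in> U" for x
  proof -
    have Gfx: "(g has_derivative G (f x)) (at (f x))"
      using that assms(5) G(1) by auto
    then have lin: "linear (G (f x))" by (rule has_derivative_linear)
    have "G (f x) w = (\<Sum>i\<in>Basis. (w \<bullet> i) *\<^sub>R G (f x) i)" for w
    proof -
      have "G (f x) (\<Sum>i\<in>Basis. (w \<bullet> i) *\<^sub>R i) = (\<Sum>i\<in>Basis. (w \<bullet> i) *\<^sub>R G (f x) i)"
        unfolding linear_sum[OF lin] by (intro sum.cong refl linear_scale[OF lin])
      then show ?thesis unfolding euclidean_representation .
    qed
    then have "(\<lambda>v. G (f x) (F x v)) = (\<lambda>v. \<Sum>i\<in>Basis. (F x v \<bullet> i) *\<^sub>R G (f x) i)" by (intro ext)
    then show ?thesis
      using has_derivative_compose[OF bspec[OF F(1) that] Gfx] by metis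
  qed
  have "C_on k U (\<lambda>x. G (f x) i)" for i
    by (rule Suc.IH[OF C_on_Suc_imp[OF assms(1) Suc.prems(1)] spec[OF G(2)]])
  then show ?case
    by (intro C_on_SucI[OF assms(1) deriv] C_on_sum C_on_scaleR C_on_inner C_on_const assms(1) spec[OF F(2)])
qed

lemma C_on_linear_compose:
  assumes "open U" "bounded_linear L" "C_on k U f"
  shows "C_on k U (\<lambda>x. L (f x))"
  by (rule C_on_compose[OF assms(1) open_UNIV assms(3) C_on_linear]) (use assms in auto)

lemma C_on_Pair:
  assumes "open U" "C_on k U f" "C_on k U g"
  shows "C_on k U (\<lambda>x. (f x, g x))"
proof -
  have "C_on k U (\<lambda>x. (f x, 0) + (0, g x))"
    using assms by (intro C_on_add C_on_linear_compose[of U "\<lambda>z. (z, 0)"]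
        C_on_linear_compose[of U "\<lambda>z. (0, z)"] bounded_linear_Pair bounded_linear_ident bounded_linear_zero)
  then show ?thesis by simp
qed

lemma C_on_minus:
  assumes "open U" "C_on k U f"
  shows "C_on k U (\<lambda>x. - f x)"
  using C_on_linear_compose[OF assms(1) bounded_linear_minus[OF bounded_linear_ident] assms(2)] .

lemma C_on_diff:
  assumes "open U" "C_on k U f" "C_on k U g"
  shows "C_on k U (\<lambda>x. f x - g x)"
  using C_on_add[OF assms(1,2) C_on_minus[OF assms(1,3)]] by simp

text \<open>The derivative of each elementary function below is composed of the function itself and of
  functions already treated, by operations that preserve \<open>C\<^sup>k\<close>. Hence if the function is \<open>C\<^sup>k\<close>,
  then so is its derivative.\<close>

lemma C_on_inverse_nonzero:
  "C_on k (- {0}) (inverse :: 'a \<Rightarrow> 'a::{real_normed_field, euclidean_space})"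
proof (induction k)
  case 0
  then show ?case by (auto intro!: continuous_intros)
next
  case (Suc k)
  show ?case
    by (rule C_on_SucI[where D = "\<lambda>x v. - (inverse x * v * inverse x)"])
      (auto intro!: has_derivative_inverse' C_on_minus C_on_mult C_on_const Suc)
qed

lemma C_on_inverse:
  fixes f :: "'a::euclidean_space \<Rightarrow> 'b::{real_normed_field, euclidean_space}"
  assumes "open U" "C_on k U f" "\<And>x. x \<in> U \<Longrightarrow> f x \<noteq> 0"
  shows "C_on k U (\<lambda>x. inverse (f x))"
  by (rule C_on_compose[OF assms(1) _ assms(2) C_on_inverse_nonzero]) (use assms in auto)

lemma C_on_exp:
  assumes "open U" "C_on k U f"
  shows "C_on k U (\<lambda>x. exp (f x :: real))"
proof (rule C_on_compose[OF assms(1) open_UNIV assms(2)])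
  show "C_on k UNIV (exp :: real \<Rightarrow> real)"
  proof (induction k)
    case (Suc k)
    have "C_on k UNIV (\<lambda>x. exp x * v)" for v :: real
      by (intro C_on_mult C_on_const Suc open_UNIV)
    then show ?case
      using DERIV_exp by (intro C_on_SucI[where D = "\<lambda>x v. exp x * v"])
        (auto simp: has_field_derivative_def)
  qed (auto intro!: continuous_intros)
qed simp

lemma C_on_ln:
  assumes "open U" "C_on k U f" "\<And>x. x \<in> U \<Longrightarrow> 0 < (f x :: real)"
  shows "C_on k U (\<lambda>x. ln (f x))"
proof (rule C_on_compose[OF assms(1) _ assms(2)])
  \<comment> \<open>No induction: the derivative \<open>1 / x\<close> is already known to be smooth.\<close>
  show "C_on k {0<..} (ln :: real \<Rightarrow> real)"
  proof (cases k)
    case (Suc m)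
    have "C_on m {0<..} (\<lambda>x. inverse x * v)" for v :: real
      by (intro C_on_mult C_on_const C_on_inverse C_on_linear bounded_linear_ident) auto
    then show ?thesis unfolding Suc
      using DERIV_ln by (intro C_on_SucI[where D = "\<lambda>x v. inverse x * v"])
        (auto simp: has_field_derivative_def)
  qed (auto intro!: continuous_intros)
qed (use assms in auto)

lemma C_on_sqrt:
  assumes "open U" "C_on k U f" "\<And>x. x \<in> U \<Longrightarrow> 0 < f x"
  shows "C_on k U (\<lambda>x. sqrt (f x))"
proof (rule C_on_compose[OF assms(1) _ assms(2)])
  show "C_on k {0<..} sqrt"
  proof (induction k)
    case (Suc k)
    have "C_on k {0<..} (\<lambda>x. inverse (sqrt x) / 2 * v)" for v :: real
      unfolding divide_inverse by (intro C_on_mult C_on_const C_on_inverse Suc) auto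
    then show ?case
      by (intro C_on_SucI[where D = "\<lambda>x. (*) (inverse (sqrt x) / 2)"]
          has_field_derivative_imp_has_derivative DERIV_real_sqrt) auto
  qed (auto intro!: continuous_intros)
qed (use assms in auto)

section \<open>Smooth maps on subsets of Euclidean spaces\<close>

lemma smooth_map_onI:
  assumes "open U" "X \<subseteq> U" "\<And>k. C_on k U g" "\<And>x. x \<in> X \<Longrightarrow> g x = f x"
  shows "smooth_map_on X f"
  using assms unfolding smooth_map_on_def by blast

lemma smooth_map_on_linear: "bounded_linear L \<Longrightarrow> smooth_map_on X L"
  by (rule smooth_map_onI[of UNIV]) (auto intro: C_on_linear)

lemma smooth_map_onE:
  assumes "smooth_map_on X f" "x \<in> X"
  obtains U g where "open U" "x \<in> U" "\<And>k. C_on k U g" "\<And>y. y \<in> U \<Longrightarrow> y \<in> X \<Longrightarrow> g y = f y"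
proof -
  obtain U g where "open U" "x \<in> U" "\<forall>k. C_on k U g" "\<forall>y\<in>U \<inter> X. g y = f y"
    using assms unfolding smooth_map_on_def by blast
  then show thesis by (intro that[of U g]) auto
qed

text \<open>Extensions of two maps are defined on different neighbourhoods of a point; it is enough to
  find an extension of the combined map on one smaller neighbourhood.\<close>

lemma smooth_map_on_locallyI:
  assumes "\<And>x. x \<in> X \<Longrightarrow> \<exists>U. open U \<and> x \<in> U \<and> smooth_map_on (U \<inter> X) f"
  shows "smooth_map_on X f"
  unfolding smooth_map_on_def
proof
  fix x assume x: "x \<in> X"
  obtain U where U: "open U" "x \<in> U" "smooth_map_on (U \<inter> X) f" using assms[OF x] by blast
  obtain V g where V: "open V" "x \<in> V" "\<And>k. C_on k V g" "\<And>y. y \<in> V \<Longrightarrow> y \<in> U \<inter> X \<Longrightarrow> g y = f y"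
    using smooth_map_onE[OF U(3), of x] U(2) x by auto
  show "\<exists>U g. open U \<and> x \<in> U \<and> (\<forall>k. C_on k U g) \<and> (\<forall>y\<in>U \<inter> X. g y = f y)"
    by (intro exI[of _ "U \<inter> V"] exI[of _ g])
      (use U(1,2) V C_on_subset[OF V(3), of "U \<inter> V"] in auto)
qed

lemma smooth_map_on_subset:
  assumes "smooth_map_on X f" "Y \<subseteq> X"
  shows "smooth_map_on Y f"
  unfolding smooth_map_on_def
proof
  fix x assume "x \<in> Y"
  then obtain U g where "open U" "x \<in> U" "\<And>k. C_on k U g" "\<And>y. y \<in> U \<Longrightarrow> y \<in> X \<Longrightarrow> g y = f y"
    using smooth_map_onE[OF assms(1)] assms(2) by (metis subsetD)
  then show "\<exists>U g. open U \<and> x \<in> U \<and> (\<forall>k. C_on k U g) \<and> (\<forall>y\<in>U \<inter> Y. g y = f y)"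
    using assms(2) by (intro exI[of _ U] exI[of _ g]) auto
qed

lemma smooth_map_on_cong:
  assumes "smooth_map_on X f" "\<And>x. x \<in> X \<Longrightarrow> f x = g x"
  shows "smooth_map_on X g"
  using assms unfolding smooth_map_on_def by (metis Int_iff)

lemma smooth_map_on_imp_continuous_on:
  assumes "smooth_map_on X f"
  shows "continuous_on X f"
  unfolding continuous_on_eq_continuous_within
proof
  fix x assume x: "x \<in> X"
  obtain U g where U: "open U" "x \<in> U" "\<And>k. C_on k U g" "\<And>y. y \<in> U \<Longrightarrow> y \<in> X \<Longrightarrow> g y = f y"
    using smooth_map_onE[OF assms x] by blast
  have "continuous_on U g" using C_on_imp_continuous_on[OF U(1)] U(3) by blast
  then have "continuous (at x within X) g"
    using U(1,2) by (simp add: continuous_on_eq_continuous_at continuous_at_imp_continuous_at_within)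
  then show "continuous (at x within X) f"
    by (rule continuous_transform_within_openin[where S = "X \<inter> U" and T = X])
      (use U x in \<open>auto simp: openin_open_Int\<close>)
qed

lemma smooth_map_on_compose:
  assumes "smooth_map_on X f" "smooth_map_on Y g" "f ` X \<subseteq> Y"
  shows "smooth_map_on X (\<lambda>x. g (f x))"
proof (rule smooth_map_on_locallyI)
  fix x assume x: "x \<in> X"
  obtain U F where U: "open U" "x \<in> U" "\<And>k. C_on k U F" "\<And>y. y \<in> U \<Longrightarrow> y \<in> X \<Longrightarrow> F y = f y"
    using smooth_map_onE[OF assms(1) x] by blast
  obtain V G where V: "open V" "f x \<in> V" "\<And>k. C_on k V G" "\<And>y. y \<in> V \<Longrightarrow> y \<in> Y \<Longrightarrow> G y = g y"
    using smooth_map_onE[OF assms(2), of "f x"] assms(3) x by blast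
  let ?W = "U \<inter> F -` V"
  have W: "open ?W"
    using C_on_imp_continuous_on[OF U(1)] U(1,3) V(1) continuous_open_preimage by blast
  have "C_on k ?W (\<lambda>x. G (F x))" for k
    by (rule C_on_compose[OF W V(1) C_on_subset[OF U(3)] V(3)]) auto
  moreover have "G (F y) = g (f y)" if "y \<in> ?W \<inter> X" for y
    using that U(4)[of y] V(4)[of "f y"] assms(3) by auto
  ultimately have "smooth_map_on (?W \<inter> X) (\<lambda>x. g (f x))"
    by (intro smooth_map_onI[OF W, of _ "\<lambda>x. G (F x)"]) auto
  moreover have "x \<in> ?W" using U(2) U(4)[OF U(2) x] V(2) by simp
  ultimately show "\<exists>U. open U \<and> x \<in> U \<and> smooth_map_on (U \<inter> X) (\<lambda>x. g (f x))"
    using W by blast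
qed

lemma smooth_map_on_Pair:
  assumes "smooth_map_on X f" "smooth_map_on X g"
  shows "smooth_map_on X (\<lambda>x. (f x, g x))"
proof (rule smooth_map_on_locallyI)
  fix x assume x: "x \<in> X"
  obtain U F where U: "open U" "x \<in> U" "\<And>k. C_on k U F" "\<And>y. y \<in> U \<Longrightarrow> y \<in> X \<Longrightarrow> F y = f y"
    using smooth_map_onE[OF assms(1) x] by blast
  obtain V G where V: "open V" "x \<in> V" "\<And>k. C_on k V G" "\<And>y. y \<in> V \<Longrightarrow> y \<in> X \<Longrightarrow> G y = g y"
    using smooth_map_onE[OF assms(2) x] by blast
  have W: "open (U \<inter> V)" using U V by auto
  have "C_on k (U \<inter> V) (\<lambda>x. (F x, G x))" for k
    by (rule C_on_Pair[OF W C_on_subset[OF U(3)] C_on_subset[OF V(3)]]) auto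
  then have "smooth_map_on (U \<inter> V \<inter> X) (\<lambda>x. (f x, g x))"
    by (intro smooth_map_onI[OF W, of _ "\<lambda>x. (F x, G x)"]) (use U(4) V(4) in auto)
  then show "\<exists>U. open U \<and> x \<in> U \<and> smooth_map_on (U \<inter> X) (\<lambda>x. (f x, g x))"
    using W U(2) V(2) by blast
qed

lemma smooth_map_on_Times:
  assumes "smooth_map_on X f" "smooth_map_on Y g"
  shows "smooth_map_on (X \<times> Y) (\<lambda>p. (f (fst p), g (snd p)))"
  by (intro smooth_map_on_Pair smooth_map_on_compose[OF _ assms(1)] smooth_map_on_compose[OF _ assms(2)]
      smooth_map_on_linear bounded_linear_fst bounded_linear_snd) auto

section \<open>Diffeomorphisms and submanifolds\<close>

lemma diffeomorphismI:
  assumes "smooth_map_on X f" "smooth_map_on Y g"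
    "\<And>x. x \<in> X \<Longrightarrow> f x \<in> Y" "\<And>y. y \<in> Y \<Longrightarrow> g y \<in> X"
    "\<And>x. x \<in> X \<Longrightarrow> g (f x) = x" "\<And>y. y \<in> Y \<Longrightarrow> f (g y) = y"
  shows "diffeomorphism X Y f g"
proof -
  have "f ` X = Y" "g ` Y = X" using assms(3-6) by (auto simp: image_iff) metis+
  then show ?thesis using assms unfolding diffeomorphism_def by blast
qed

lemma diffeomorphism_sym: "diffeomorphism X Y f g \<Longrightarrow> diffeomorphism Y X g f"
  unfolding diffeomorphism_def by auto

lemma diffeomorphism_compose:
  assumes "diffeomorphism X Y f g" "diffeomorphism Y Z f' g'"
  shows "diffeomorphism X Z (\<lambda>x. f' (f x)) (\<lambda>z. g (g' z))"
proof -
  have "smooth_map_on X (\<lambda>x. f' (f x))" "smooth_map_on Z (\<lambda>z. g (g' z))"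
    using assms unfolding diffeomorphism_def by (auto intro: smooth_map_on_compose)
  moreover have "(\<lambda>x. f' (f x)) ` X = f' ` (f ` X)" "(\<lambda>z. g (g' z)) ` Z = g ` (g' ` Z)"
    by auto
  ultimately show ?thesis using assms unfolding diffeomorphism_def by auto
qed

lemma diffeomorphism_restrict:
  assumes "diffeomorphism X Y f g" "V \<subseteq> X"
  shows "diffeomorphism V (f ` V) f g"
proof -
  have "smooth_map_on V f" "smooth_map_on (f ` V) g"
    using assms unfolding diffeomorphism_def by (auto intro: smooth_map_on_subset)
  moreover have "g (f x) = x" if "x \<in> V" for x
    using assms that unfolding diffeomorphism_def by auto
  ultimately show ?thesis unfolding diffeomorphism_def by force
qed

lemma diffeomorphism_Times:
  assumes "diffeomorphism X Y f g" "diffeomorphism X' Y' f' g'"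
  shows "diffeomorphism (X \<times> X') (Y \<times> Y')
    (\<lambda>p. (f (fst p), f' (snd p))) (\<lambda>p. (g (fst p), g' (snd p)))"
  by (rule diffeomorphismI)
    (use assms in \<open>auto simp: diffeomorphism_def intro!: smooth_map_on_Times\<close>)

text \<open>A chart of \<open>M\<close> composed with the diffeomorphism is a chart of \<open>N\<close>; its domain is open because
  the inverse map is continuous.\<close>

lemma smooth_submanifold_diffeomorphic:
  assumes "smooth_submanifold TYPE('e::euclidean_space) M" "diffeomorphism M N f g"
  shows "smooth_submanifold TYPE('e) N"
  unfolding smooth_submanifold_def
proof
  fix y assume y: "y \<in> N"
  then have gy: "g y \<in> M" using assms(2) unfolding diffeomorphism_def by auto
  then obtain V and U :: "'e set" and \<phi> \<psi> where
    V: "openin (top_of_set M) V" "g y \<in> V" "open U" "diffeomorphism V U \<phi> \<psi>"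
    using assms(1) unfolding smooth_submanifold_def by blast
  have VM: "V \<subseteq> M" using V(1) openin_imp_subset by blast
  have "continuous_on N g" "g ` N \<subseteq> M"
    using assms(2) smooth_map_on_imp_continuous_on unfolding diffeomorphism_def by auto
  then have "openin (top_of_set N) (N \<inter> g -` V)"
    using V(1) continuous_openin_preimage by blast
  moreover have "N \<inter> g -` V = f ` V"
    using assms(2) VM unfolding diffeomorphism_def by (auto intro: rev_image_eqI)
  ultimately have "openin (top_of_set N) (f ` V)" "y \<in> f ` V" using y V(2) by auto
  moreover have "diffeomorphism (f ` V) U (\<lambda>x. \<phi> (g x)) (\<lambda>z. f (\<psi> z))"
    by (rule diffeomorphism_compose[OF diffeomorphism_sym[OF diffeomorphism_restrict[OF assms(2) VM]] V(4)])
  ultimately show "\<exists>V (U :: 'e set) \<phi> \<psi>. openin (top_of_set N) V \<and> y \<in> V \<and> open U \<and> diffeomorphism V U \<phi> \<psi>"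
    using V(3) by blast
qed

lemma smooth_submanifold_Times:
  assumes "smooth_submanifold TYPE('e::euclidean_space) M" "smooth_submanifold TYPE('f::euclidean_space) N"
  shows "smooth_submanifold TYPE('e \<times> 'f) (M \<times> N)"
  unfolding smooth_submanifold_def
proof (clarify)
  fix x y assume "x \<in> M" "y \<in> N"
  then obtain V and U :: "'e set" and \<phi> \<psi> and V' and U' :: "'f set" and \<phi>' \<psi>' where
    "openin (top_of_set M) V" "x \<in> V" "open U" "diffeomorphism V U \<phi> \<psi>"
    "openin (top_of_set N) V'" "y \<in> V'" "open U'" "diffeomorphism V' U' \<phi>' \<psi>'"
    using assms unfolding smooth_submanifold_def by meson
  then show "\<exists>V (U :: ('e \<times> 'f) set) \<phi> \<psi>.
      openin (top_of_set (M \<times> N)) V \<and> (x, y) \<in> V \<and> open U \<and> diffeomorphism V U \<phi> \<psi>"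
    by (intro exI[of _ "V \<times> V'"] exI[of _ "U \<times> U'"] exI conjI)
      (auto intro: diffeomorphism_Times openin_Times open_Times)
qed

text \<open>Only the dimension of the model space matters, because spaces of equal dimension are linearly
  isomorphic.\<close>

lemma smooth_submanifold_model:
  assumes "smooth_submanifold TYPE('e::euclidean_space) M" "DIM('e) = DIM('f::euclidean_space)"
  shows "smooth_submanifold TYPE('f) M"
proof -
  obtain L :: "'e \<Rightarrow> 'f" and L' where L: "linear L" "linear L'" "\<And>x. L' (L x) = x" "\<And>y. L (L' y) = y"
    using isomorphisms_UNIV_UNIV[OF assms(2)] by metis
  have diff: "diffeomorphism UNIV UNIV L L'"
    using L by (intro diffeomorphismI smooth_map_on_linear) (auto simp: linear_conv_bounded_linear)
  show ?thesis
    unfolding smooth_submanifold_def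
  proof
    fix x assume "x \<in> M"
    then obtain V and U :: "'e set" and \<phi> \<psi> where
      V: "openin (top_of_set M) V" "x \<in> V" "open U" "diffeomorphism V U \<phi> \<psi>"
      using assms(1) unfolding smooth_submanifold_def by blast
    have "continuous_on UNIV L'" using L(2) by (simp add: linear_continuous_on linear_conv_bounded_linear)
    then have "open (L' -` U)" using V(3) open_vimage by blast
    moreover have "L' -` U = L ` U" using L(3,4) by (auto intro: rev_image_eqI)
    moreover have "diffeomorphism V (L ` U) (\<lambda>x. L (\<phi> x)) (\<lambda>y. \<psi> (L' y))"
      by (rule diffeomorphism_compose[OF V(4) diffeomorphism_restrict[OF diff]]) simp
    ultimately show "\<exists>V (U :: 'f set) \<phi> \<psi>. openin (top_of_set M) V \<and> x \<in> V \<and> open U \<and> diffeomorphism V U \<phi> \<psi>"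
      using V(1,2) by metis
  qed
qed

lemma smooth_submanifold_UNIV: "smooth_submanifold TYPE('e::euclidean_space) (UNIV :: 'e set)"
  unfolding smooth_submanifold_def diffeomorphism_def
  by (intro ballI exI[of _ UNIV] exI[of _ "\<lambda>x. x"]) (auto intro!: smooth_map_on_linear bounded_linear_ident)

section \<open>Lie groups\<close>

lemma lie_group_model:
  assumes "lie_group TYPE('e::euclidean_space) G" "DIM('e) = DIM('f::euclidean_space)"
  shows "lie_group TYPE('f) G"
  using assms smooth_submanifold_model[where 'e = 'e and 'f = 'f] unfolding lie_group_def by auto

lemma lie_group_DirProd:
  assumes G: "lie_group TYPE('e::euclidean_space) G" and H: "lie_group TYPE('f::euclidean_space) H"
  shows "lie_group TYPE('e \<times> 'f) (G \<times>\<times> H)"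
proof -
  let ?C = "(carrier G \<times> carrier H) \<times> (carrier G \<times> carrier H)"
  have groups: "group G" "group H"
    and mult: "smooth_map_on (carrier G \<times> carrier G) (\<lambda>(x, y). x \<otimes>\<^bsub>G\<^esub> y)"
      "smooth_map_on (carrier H \<times> carrier H) (\<lambda>(x, y). x \<otimes>\<^bsub>H\<^esub> y)"
    and inv: "smooth_map_on (carrier G) (\<lambda>x. inv\<^bsub>G\<^esub> x)" "smooth_map_on (carrier H) (\<lambda>x. inv\<^bsub>H\<^esub> x)"
    using G H unfolding lie_group_def by auto
  have proj: "smooth_map_on ?C (\<lambda>p. (fst (fst p), fst (snd p)))" "smooth_map_on ?C (\<lambda>p. (snd (fst p), snd (snd p)))"
    by (intro smooth_map_on_linear bounded_linear_Pair bounded_linear_fst_comp bounded_linear_snd_comp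
        bounded_linear_fst bounded_linear_snd)+
  have "smooth_map_on ?C (\<lambda>(x, y). x \<otimes>\<^bsub>G \<times>\<times> H\<^esub> y)"
    by (rule smooth_map_on_cong[OF smooth_map_on_Pair[OF smooth_map_on_compose[OF proj(1) mult(1)]
            smooth_map_on_compose[OF proj(2) mult(2)]]]) auto
  moreover have "smooth_map_on (carrier G \<times> carrier H) (\<lambda>x. inv\<^bsub>G \<times>\<times> H\<^esub> x)"
    by (rule smooth_map_on_cong[OF smooth_map_on_Times[OF inv]]) (auto simp: inv_DirProd groups)
  moreover have "smooth_submanifold TYPE('e \<times> 'f) (carrier G \<times> carrier H)"
    using G H unfolding lie_group_def by (intro smooth_submanifold_Times) auto
  ultimately show ?thesis
    using groups unfolding lie_group_def carrier_DirProd by (intro conjI DirProd_group)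
qed

text \<open>The operations of the target are those of the source conjugated by the diffeomorphism.\<close>

lemma lie_group_transfer:
  assumes G: "lie_group TYPE('e::euclidean_space) G" and "group H"
    and f: "f \<in> iso G H" and diff: "diffeomorphism (carrier G) (carrier H) f g"
  shows "lie_group TYPE('e) H"
proof -
  interpret G: group G using G unfolding lie_group_def by auto
  interpret H: group H by fact
  interpret group_hom G H f using f by unfold_locales (auto simp: iso_def)
  have g: "g y \<in> carrier G" "f (g y) = y" if "y \<in> carrier H" for y
    using diff that unfolding diffeomorphism_def by auto
  have sf: "smooth_map_on (carrier G) f" and sg: "smooth_map_on (carrier H) g"
    using diff unfolding diffeomorphism_def by auto
  have "smooth_map_on (carrier H \<times> carrier H)
      (\<lambda>p. f (case (g (fst p), g (snd p)) of (x, y) \<Rightarrow> x \<otimes>\<^bsub>G\<^esub> y))"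
    using G unfolding lie_group_def
    by (intro smooth_map_on_compose[OF _ sf] smooth_map_on_compose[OF smooth_map_on_Times[OF sg sg]])
      (auto simp: g)
  then have "smooth_map_on (carrier H \<times> carrier H) (\<lambda>(x, y). x \<otimes>\<^bsub>H\<^esub> y)"
    by (rule smooth_map_on_cong) (auto simp: g)
  moreover have "smooth_map_on (carrier H) (\<lambda>y. f (inv\<^bsub>G\<^esub> (g y)))"
    using G unfolding lie_group_def
    by (intro smooth_map_on_compose[OF _ sf] smooth_map_on_compose[OF sg]) (auto simp: g)
  then have "smooth_map_on (carrier H) (\<lambda>y. inv\<^bsub>H\<^esub> y)"
    by (rule smooth_map_on_cong) (auto simp: g)
  ultimately show ?thesis
    using G diff \<open>group H\<close> smooth_submanifold_diffeomorphic[of "carrier G" "carrier H"]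
    unfolding lie_group_def by auto
qed

section \<open>The circle and the real line\<close>

lemma comm_group_circle: "comm_group circle_group"
proof (rule comm_groupI)
  show "\<exists>y\<in>carrier circle_group. y \<otimes>\<^bsub>circle_group\<^esub> x = \<one>\<^bsub>circle_group\<^esub>"
    if "x \<in> carrier circle_group" for x
    using that complex_norm_square[of x]
    by (intro bexI[of _ "cnj x"]) (auto simp: circle_group_def mult.commute)
qed (auto simp: circle_group_def norm_mult)

lemma inv_circle:
  assumes "x \<in> sphere 0 1"
  shows "inv\<^bsub>circle_group\<^esub> x = cnj x"
proof -
  interpret comm_group circle_group by (rule comm_group_circle)
  show ?thesis
    using assms complex_norm_square[of x]
    by (intro inv_equality) (auto simp: circle_group_def mult.commute)
qed

text \<open>The projection from the point \<open>- 1\<close> onto the imaginary axis, whose inverse is the Cayley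
  transform \<open>(1 + \<i> t) / (1 - \<i> t)\<close>. Unlike an angle, it needs no choice of a branch, and both
  directions are rational.\<close>

lemma diffeomorphism_stereographic:
  "diffeomorphism (sphere 0 1 - {- 1}) UNIV (\<lambda>w. Im w / (1 + Re w))
    (\<lambda>t. Complex ((1 - t\<^sup>2) / (1 + t\<^sup>2)) (2 * t / (1 + t\<^sup>2)))"
    (is "diffeomorphism ?V UNIV ?\<phi> ?\<psi>")
proof -
  have Re: "1 + Re w \<noteq> 0" and sq: "(Re w)\<^sup>2 + (Im w)\<^sup>2 = 1" if "w \<in> ?V" for w
  proof -
    show sq: "(Re w)\<^sup>2 + (Im w)\<^sup>2 = 1" using that by (simp add: cmod_def)
    show "1 + Re w \<noteq> 0"
    proof
      assume "1 + Re w = 0"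
      then have "Re w = - 1" by simp
      then have "w = - 1" using sq by (simp add: complex_eq_iff)
      then show False using that by simp
    qed
  qed
  have pos: "0 < 1 + t\<^sup>2" for t :: real by (simp add: add_pos_nonneg)
  have V: "?\<psi> t \<in> ?V" for t
  proof -
    have "((1 - t\<^sup>2) / (1 + t\<^sup>2))\<^sup>2 + (2 * t / (1 + t\<^sup>2))\<^sup>2 = ((1 - t\<^sup>2)\<^sup>2 + (2 * t)\<^sup>2) / (1 + t\<^sup>2)\<^sup>2"
      by (simp add: power_divide add_divide_distrib)
    also have "(1 - t\<^sup>2)\<^sup>2 + (2 * t)\<^sup>2 = (1 + t\<^sup>2)\<^sup>2" by (simp add: power2_eq_square algebra_simps)
    finally have "cmod (?\<psi> t) = 1" using pos[of t] by (simp add: cmod_def)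
    moreover have "(1 - t\<^sup>2) / (1 + t\<^sup>2) \<noteq> - 1" using pos[of t] by (simp add: divide_eq_eq)
    ultimately show ?thesis by (auto simp: complex_eq_iff)
  qed
  have left: "?\<psi> (?\<phi> w) = w" if "w \<in> ?V" for w
  proof -
    define x y where "x = Re w" and "y = Im w"
    have x: "1 + x \<noteq> 0" and y: "y\<^sup>2 = (1 - x) * (1 + x)"
      using Re[OF that] sq[OF that] by (auto simp: x_def y_def algebra_simps power2_eq_square)
    have t2: "(y / (1 + x))\<^sup>2 = (1 - x) / (1 + x)"
      using x by (simp add: power_divide y) (simp add: power2_eq_square)
    have "1 + (1 - x) / (1 + x) = 2 / (1 + x)" "1 - (1 - x) / (1 + x) = 2 * x / (1 + x)"
      using x by (simp_all add: field_simps)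
    then have "?\<psi> (y / (1 + x)) = Complex x y"
      unfolding t2 using x by simp
    then show ?thesis by (simp add: x_def y_def)
  qed
  have right: "?\<phi> (?\<psi> t) = t" for t
  proof -
    have "1 + (1 - t\<^sup>2) / (1 + t\<^sup>2) = 2 / (1 + t\<^sup>2)" using pos[of t] by (simp add: field_simps)
    then show ?thesis using pos[of t] by simp
  qed
  have smooth: "smooth_map_on ?V ?\<phi>"
  proof (rule smooth_map_onI)
    show "open {w. 1 + Re w \<noteq> 0}" by (intro open_Collect_neq continuous_intros)
    then show "C_on k {w. 1 + Re w \<noteq> 0} (\<lambda>w. Im w * inverse (1 + Re w))" for k
      by (intro C_on_mult C_on_inverse C_on_add C_on_const C_on_linear bounded_linear_Re bounded_linear_Im) auto
  qed (use Re in \<open>auto simp: divide_inverse\<close>)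
  have nz: "1 + t * t \<noteq> 0" for t :: real
    using pos[of t] by (simp add: power2_eq_square)
  have "smooth_map_on UNIV ?\<psi>"
  proof (rule smooth_map_onI)
    have num: "C_on k UNIV (\<lambda>t. t)" for k
      by (intro C_on_linear bounded_linear_ident open_UNIV)
    show "C_on k UNIV (\<lambda>t. of_real ((1 - t * t) * inverse (1 + t * t)) +
        \<i> * of_real (2 * t * inverse (1 + t * t)))" for k
      by (intro C_on_add C_on_mult C_on_const C_on_linear_compose[OF _ bounded_linear_of_real]
          C_on_diff C_on_inverse num nz open_UNIV)
  qed (use nz in \<open>auto simp: complex_eq_iff divide_inverse power2_eq_square\<close>)
  then show ?thesis
    using smooth V left right by (intro diffeomorphismI) auto
qed

text \<open>Rotating the stereographic chart centred at \<open>1\<close> gives one around every point.\<close>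

lemma smooth_submanifold_circle: "smooth_submanifold TYPE(real) (sphere (0 :: complex) 1)"
  unfolding smooth_submanifold_def
proof
  fix z :: complex assume z: "z \<in> sphere 0 1"
  then have zz: "z * cnj z = 1" using complex_norm_square[of z] by simp
  have rot: "diffeomorphism (sphere 0 1) (sphere 0 1) (\<lambda>w. z * w) (\<lambda>w. cnj z * w)"
  proof -
    have inverse: "z * (cnj z * w) = w" "cnj z * (z * w) = w" for w
      using zz by (simp_all add: mult.assoc[symmetric] mult.commute[of _ z])
    then show ?thesis
      using z by (intro diffeomorphismI smooth_map_on_linear bounded_linear_mult_right) (auto simp: norm_mult)
  qed
  let ?V = "sphere 0 1 - {- 1} :: complex set"
  let ?W = "(\<lambda>w. z * w) ` ?V"
  have chart: "\<exists>\<phi> \<psi>. diffeomorphism ?W (UNIV :: real set) \<phi> \<psi>"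
    using diffeomorphism_compose[OF diffeomorphism_sym[OF diffeomorphism_restrict[OF rot]]
        diffeomorphism_stereographic] by blast
  have "z \<noteq> 0" using z by auto
  then have "z * w = - z \<longleftrightarrow> w = - 1" for w
    by (metis mult_cancel_left mult_minus1_right)
  then have "?W = (\<lambda>w. z * w) ` sphere 0 1 - {- z}" by auto
  also have "(\<lambda>w. z * w) ` sphere 0 1 = sphere 0 1" using rot unfolding diffeomorphism_def by blast
  finally have W: "?W = sphere 0 1 - {- z}" .
  then have "openin (top_of_set (sphere 0 1)) ?W"
    by (metis Diff_eq openin_open_Int open_Compl closed_singleton)
  moreover have "z \<in> ?W" using z unfolding W by (auto simp: eq_neg_iff_add_eq_0)
  ultimately show "\<exists>V (U :: real set) \<phi> \<psi>. openin (top_of_set (sphere 0 1)) V \<and> z \<in> V \<and> open U \<and>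
      diffeomorphism V U \<phi> \<psi>"
    using chart open_UNIV by blast
qed

lemma lie_group_circle: "lie_group TYPE(real) circle_group"
proof -
  interpret comm_group circle_group by (rule comm_group_circle)
  have "smooth_map_on (sphere 0 1 \<times> sphere 0 1) (\<lambda>(x, y). x * y :: complex)"
    by (rule smooth_map_onI[of UNIV _ "\<lambda>p. fst p * snd p"])
      (intro C_on_mult C_on_linear bounded_linear_fst bounded_linear_snd open_UNIV | force)+
  moreover have "smooth_map_on (sphere 0 1) (\<lambda>x. inv\<^bsub>circle_group\<^esub> x)"
    by (rule smooth_map_on_cong[OF smooth_map_on_linear[OF bounded_linear_cnj]]) (simp add: inv_circle)
  ultimately show ?thesis
    unfolding lie_group_def using is_group smooth_submanifold_circle by (simp add: circle_group_def)
qed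

lemma comm_group_real_add: "comm_group real_add_group"
proof (rule comm_groupI)
  show "\<exists>y\<in>carrier real_add_group. y \<otimes>\<^bsub>real_add_group\<^esub> x = \<one>\<^bsub>real_add_group\<^esub>" for x
    by (intro bexI[of _ "- x"]) (auto simp: real_add_group_def)
qed (auto simp: real_add_group_def)

lemma lie_group_real_add: "lie_group TYPE(real) real_add_group"
proof -
  interpret comm_group real_add_group by (rule comm_group_real_add)
  have inv: "inv\<^bsub>real_add_group\<^esub> x = - x" for x
    by (rule inv_equality) (auto simp: real_add_group_def)
  have "smooth_map_on (UNIV \<times> UNIV) (\<lambda>(x, y). x + y :: real)"
    by (rule smooth_map_onI[of UNIV _ "\<lambda>p. fst p + snd p"])
      (intro C_on_add C_on_linear bounded_linear_fst bounded_linear_snd open_UNIV | force)+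
  moreover have "smooth_map_on UNIV (\<lambda>x. inv\<^bsub>real_add_group\<^esub> x)"
    unfolding inv by (intro smooth_map_on_linear bounded_linear_minus bounded_linear_ident)
  ultimately show ?thesis
    unfolding lie_group_def using is_group smooth_submanifold_UNIV by (simp add: real_add_group_def)
qed

lemma comm_group_DirProd:
  assumes "comm_group G" "comm_group H"
  shows "comm_group (G \<times>\<times> H)"
proof -
  interpret G: comm_group G by fact
  interpret H: comm_group H by fact
  interpret group "G \<times>\<times> H" by (intro DirProd_group G.is_group H.is_group)
  show ?thesis by (rule group_comm_groupI) (auto simp: G.m_comm H.m_comm)
qed

section \<open>Parametrization of the one-dimensional modules\<close>

definition param :: "complex \<times> complex \<times> real \<Rightarrow> complex \<times> complex" where
  "param = (\<lambda>(u, v, t). (u / of_real (sqrt (exp t + 1)), of_real (sqrt (exp t / (exp t + 1))) * v))"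

text \<open>On the image of \<open>(u, v, t)\<close> the quotient \<open>\<bar>b\<bar>\<^sup>2 / \<bar>a\<bar>\<^sup>2\<close> is \<open>e\<^sup>t\<close>. The difference of logarithms
  recovers \<open>t\<close> from it.\<close>

definition coords :: "complex \<times> complex \<Rightarrow> complex \<times> complex \<times> real" where
  "coords = (\<lambda>(a, b). (sgn a, sgn b, ln ((cmod b)\<^sup>2) - ln ((cmod a)\<^sup>2)))"

abbreviation param_group :: "(complex \<times> complex \<times> real) monoid" where
  "param_group \<equiv> circle_group \<times>\<times> (circle_group \<times>\<times> real_add_group)"

lemma carrier_param_group: "carrier param_group = sphere 0 1 \<times> sphere 0 1 \<times> UNIV"
  by (simp add: circle_group_def real_add_group_def)

lemma exp_plus_1_pos: "0 < exp t + (1 :: real)"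
  by (simp add: add_pos_pos)

lemma cmod_param:
  assumes "cmod u = 1" "cmod v = 1" "param (u, v, t) = (a, b)"
  shows "(cmod a)\<^sup>2 = 1 / (exp t + 1)" "(cmod b)\<^sup>2 = exp t / (exp t + 1)"
  using assms exp_plus_1_pos[of t]
  by (auto simp: param_def norm_divide norm_mult power_divide)

lemma param_in_Irr:
  assumes "cmod u = 1" "cmod v = 1"
  shows "param (u, v, t) \<in> Irr_diff1"
proof -
  obtain a b where ab: "param (u, v, t) = (a, b)" by fastforce
  note ab2 = cmod_param[OF assms ab]
  have "(cmod a)\<^sup>2 + (cmod b)\<^sup>2 = 1" "0 < (cmod a)\<^sup>2" "0 < (cmod b)\<^sup>2"
    unfolding ab2 using exp_plus_1_pos[of t] by (auto simp: add_divide_distrib[symmetric] add.commute)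
  then show ?thesis by (auto simp: ab Irr_diff1_def)
qed

lemma coords_param:
  assumes "cmod u = 1" "cmod v = 1"
  shows "coords (param (u, v, t)) = (u, v, t)"
proof -
  obtain a b where ab: "param (u, v, t) = (a, b)" by fastforce
  have "sgn a = u" "sgn b = v"
    using ab assms exp_plus_1_pos[of t]
    by (auto simp: param_def sgn_eq norm_mult norm_divide)
  moreover have "ln ((cmod b)\<^sup>2) - ln ((cmod a)\<^sup>2) = t"
    unfolding cmod_param[OF assms ab] using exp_plus_1_pos[of t] by (simp add: ln_div)
  ultimately show ?thesis by (simp add: ab coords_def)
qed

lemma param_coords:
  assumes "p \<in> Irr_diff1"
  shows "param (coords p) = p"
proof -
  obtain a b where p: "p = (a, b)" by fastforce
  have ab: "a \<noteq> 0" "b \<noteq> 0" "(cmod a)\<^sup>2 + (cmod b)\<^sup>2 = 1"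
    using assms by (auto simp: p Irr_diff1_def)
  define t where "t = ln ((cmod b)\<^sup>2) - ln ((cmod a)\<^sup>2)"
  have t: "exp t = (cmod b)\<^sup>2 / (cmod a)\<^sup>2" using ab by (simp add: t_def exp_diff)
  then have t1: "exp t + 1 = 1 / (cmod a)\<^sup>2" using ab by (simp add: field_simps)
  then have "exp t / (exp t + 1) = (cmod b)\<^sup>2" using ab by (simp add: t)
  moreover have "sqrt (exp t + 1) = 1 / cmod a" unfolding t1 by (simp add: real_sqrt_divide)
  ultimately show ?thesis
    using ab by (simp add: p coords_def param_def t_def[symmetric] sgn_eq)
qed

lemma coords_in: "p \<in> Irr_diff1 \<Longrightarrow> coords p \<in> carrier param_group"
  unfolding carrier_param_group by (auto simp: coords_def Irr_diff1_def norm_sgn)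

lemma smooth_param: "smooth_map_on X param"
proof (rule smooth_map_onI)
  have proj: "C_on k UNIV (\<lambda>p :: complex \<times> complex \<times> real. fst p)"
    "C_on k UNIV (\<lambda>p :: complex \<times> complex \<times> real. fst (snd p))"
    "C_on k UNIV (\<lambda>p :: complex \<times> complex \<times> real. snd (snd p))" for k
    by (intro C_on_linear open_UNIV bounded_linear_fst bounded_linear_compose[OF bounded_linear_fst]
        bounded_linear_compose[OF bounded_linear_snd] bounded_linear_snd)+
  show "C_on k UNIV (\<lambda>p :: complex \<times> complex \<times> real.
      (fst p * of_real (inverse (sqrt (exp (snd (snd p)) + 1))),
       of_real (sqrt (exp (snd (snd p)) * inverse (exp (snd (snd p)) + 1))) * fst (snd p)))" for k
    by (intro C_on_Pair C_on_mult C_on_linear_compose[OF _ bounded_linear_of_real] C_on_inverse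
        C_on_sqrt C_on_add C_on_exp C_on_const proj open_UNIV)
      (auto simp: exp_plus_1_pos add_nonneg_eq_0_iff)
qed (auto simp: param_def divide_inverse)

text \<open>Away from zero, \<open>\<bar>z\<bar> = sqrt (z \<bullet> z)\<close> is composed of an inner product and a square root at a
  positive argument, so it falls under the calculus above.\<close>

lemma smooth_coords: "smooth_map_on Irr_diff1 coords"
proof (rule smooth_map_onI)
  let ?U = "(- {0}) \<times> (- {0}) :: (complex \<times> complex) set"
  show U: "open ?U" by (intro open_Times) auto
  have proj: "C_on k ?U fst" "C_on k ?U snd" for k
    by (intro C_on_linear U bounded_linear_fst bounded_linear_snd)+
  show "C_on k ?U (\<lambda>p. (inverse (sqrt (fst p \<bullet> fst p)) *\<^sub>R fst p, inverse (sqrt (snd p \<bullet> snd p)) *\<^sub>R snd p,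
      ln (snd p \<bullet> snd p) - ln (fst p \<bullet> fst p)))" for k
    by (intro C_on_Pair C_on_scaleR C_on_diff C_on_ln C_on_inverse C_on_sqrt C_on_inner proj U) auto
qed (auto simp: coords_def Irr_diff1_def sgn_div_norm norm_eq_sqrt_inner)

lemma diffeomorphism_param: "diffeomorphism (carrier param_group) Irr_diff1 param coords"
proof (rule diffeomorphismI[OF smooth_param smooth_coords])
  show "param x \<in> Irr_diff1" "coords (param x) = x" if "x \<in> carrier param_group" for x
    using that param_in_Irr coords_param unfolding carrier_param_group by auto
qed (auto simp: coords_in param_coords simp del: carrier_DirProd)

text \<open>The denominators \<open>sqrt (e\<^sup>t + 1)\<close> of the two factors occur again in the norm \<open>k\<close> that the tensor
  product divides by; they cancel and leave the denominator that belongs to \<open>t + t'\<close>.\<close>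

lemma param_mult:
  assumes "cmod u = 1" "cmod v = 1" "cmod u' = 1" "cmod v' = 1"
  shows "param (u * u', v * v', t + t') = tensor1 (param (u, v, t)) (param (u', v', t'))"
proof -
  obtain a b where ab: "param (u, v, t) = (a, b)" by fastforce
  obtain a' b' where ab': "param (u', v', t') = (a', b')" by fastforce
  define k where "k = sqrt ((cmod (a * a'))\<^sup>2 + (cmod (b * b'))\<^sup>2)"
  let ?E = "exp t + 1" and ?E' = "exp t' + 1" and ?F = "exp (t + t') + 1"
  note pos = exp_plus_1_pos[of t] exp_plus_1_pos[of t'] exp_plus_1_pos[of "t + t'"]
  have "(cmod (a * a'))\<^sup>2 + (cmod (b * b'))\<^sup>2 = ?F / (?E * ?E')"
    using cmod_param[OF assms(1,2) ab] cmod_param[OF assms(3,4) ab']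
    by (simp add: norm_mult power_mult_distrib exp_add add_divide_distrib add.commute)
  then have k: "k = sqrt ?F / (sqrt ?E * sqrt ?E')"
    by (simp add: k_def real_sqrt_divide real_sqrt_mult)
  have "1 / sqrt ?E * (1 / sqrt ?E') / k = 1 / sqrt ?F"
    using pos by (simp add: k)
  then have 1: "of_real (1 / sqrt ?E * (1 / sqrt ?E') / k) = (of_real (1 / sqrt ?F) :: complex)" by (rule arg_cong)
  have "sqrt (exp t / ?E) * sqrt (exp t' / ?E') / k = sqrt (exp (t + t') / ?F)"
    using pos by (simp add: k exp_add real_sqrt_divide real_sqrt_mult)
  then have 2: "of_real (sqrt (exp t / ?E) * sqrt (exp t' / ?E') / k) =
      (of_real (sqrt (exp (t + t') / ?F)) :: complex)" by (rule arg_cong)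
  have "a * a' \<noteq> 0"
    using param_in_Irr[OF assms(1,2), of t] param_in_Irr[OF assms(3,4), of t'] by (auto simp: ab ab' Irr_diff1_def)
  then have "tensor1 (a, b) (a', b') = (a * a' / of_real k, b * b' / of_real k)"
    unfolding k_def by (intro tensor1_formula) auto
  also have "a * a' / of_real k = u * u' * of_real (1 / sqrt ?E * (1 / sqrt ?E') / k)"
    using ab ab' by (auto simp: param_def)
  also have "b * b' / of_real k = of_real (sqrt (exp t / ?E) * sqrt (exp t' / ?E') / k) * (v * v')"
    using ab ab' by (auto simp: param_def)
  finally show ?thesis unfolding 1 2 ab ab' by (simp add: param_def)
qed

lemma param_iso: "param \<in> iso param_group Irr_diff1_group"
proof -
  have "bij_betw param (carrier param_group) (carrier Irr_diff1_group)"
    using diffeomorphism_param unfolding diffeomorphism_def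
    by (intro bij_betw_byWitness[of _ coords]) (auto simp: Irr_diff1_group_def)
  moreover have "param (x \<otimes>\<^bsub>param_group\<^esub> y) = param x \<otimes>\<^bsub>Irr_diff1_group\<^esub> param y"
    if "x \<in> carrier param_group" "y \<in> carrier param_group" for x y
    using that param_mult unfolding carrier_param_group
    by (auto simp: circle_group_def real_add_group_def Irr_diff1_group_def)
  ultimately show ?thesis
    by (auto simp: iso_def hom_def bij_betw_def)
qed

text \<open>A bijective homomorphism carries the group axioms over, with the image of the neutral element
  as neutral element; at \<open>u = v = 1\<close> and \<open>t = 0\<close> the parametrization gives \<open>(1 / sqrt 2, 1 / sqrt 2)\<close>.\<close>

lemma comm_group_Irr_diff1: "comm_group Irr_diff1_group"
proof -
  interpret comm_group param_group
    by (intro comm_group_DirProd comm_group_circle comm_group_real_add)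
  have "Irr_diff1_group\<lparr>one := param \<one>\<^bsub>param_group\<^esub>\<rparr> = Irr_diff1_group"
    by (simp add: Irr_diff1_group_def circle_group_def real_add_group_def param_def real_sqrt_divide)
  then show ?thesis using iso_imp_img_comm_group[OF param_iso] by simp
qed

text \<open>Swapping the moduli and negating the arguments makes both products equal to the same positive
  number \<open>\<bar>a\<bar> \<bar>b\<bar>\<close>, which normalization turns into \<open>1 / sqrt 2\<close>.\<close>

lemma inv_Irr_diff1:
  assumes "(a, b) \<in> Irr_diff1" "is_Arg a \<alpha>" "is_Arg b \<beta>"
  shows "inv\<^bsub>Irr_diff1_group\<^esub> (a, b) =
    (of_real (cmod b) * exp (- \<i> * of_real \<alpha>), of_real (cmod a) * exp (- \<i> * of_real \<beta>))"
proof -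
  interpret comm_group Irr_diff1_group by (rule comm_group_Irr_diff1)
  let ?a = "of_real (cmod b) * exp (- \<i> * of_real \<alpha>)" and ?b = "of_real (cmod a) * exp (- \<i> * of_real \<beta>)"
  let ?r = "cmod a * cmod b"
  have ab: "a \<noteq> 0" "b \<noteq> 0" "(cmod a)\<^sup>2 + (cmod b)\<^sup>2 = 1" using assms(1) by (auto simp: Irr_diff1_def)
  have cancel: "exp (- \<i> * of_real s) * (of_real r * exp (\<i> * of_real s)) = of_real r" for s r :: real
    by (simp add: exp_minus mult.left_commute)
  have prods: "?a * a = of_real ?r" "?b * b = of_real ?r"
    using assms(2,3) cancel[of \<alpha> "cmod a"] cancel[of \<beta> "cmod b"]
    by (simp_all add: is_Arg_def mult.assoc mult.commute)
  have norms: "cmod ?a = cmod b" "cmod ?b = cmod a" by (simp_all add: norm_mult)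
  have mem: "(?a, ?b) \<in> Irr_diff1" using ab norms by (simp add: Irr_diff1_def add.commute)
  have "sqrt ((cmod (?a * a))\<^sup>2 + (cmod (?b * b))\<^sup>2) = sqrt 2 * ?r"
    unfolding prods norm_of_real by (simp add: real_sqrt_mult)
  then have "tensor1 (?a, ?b) (a, b) = (of_real ?r / of_real (sqrt 2 * ?r), of_real ?r / of_real (sqrt 2 * ?r))"
    using tensor1_formula[of ?a a ?b b] ab prods by simp
  then have "(?a, ?b) \<otimes>\<^bsub>Irr_diff1_group\<^esub> (a, b) = \<one>\<^bsub>Irr_diff1_group\<^esub>"
    using ab by (simp add: Irr_diff1_group_def)
  then show ?thesis using assms(1) mem by (intro inv_equality) (auto simp: Irr_diff1_group_def)
qed

lemma connected_Irr_diff1: "connected Irr_diff1"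
proof -
  have "connected (carrier param_group)"
    unfolding carrier_param_group by (intro connected_Times connected_sphere connected_UNIV) auto
  then have "connected (param ` carrier param_group)"
    by (rule connected_continuous_image[OF smooth_map_on_imp_continuous_on[OF smooth_param]])
  then show ?thesis using diffeomorphism_param unfolding diffeomorphism_def by simp
qed

theorem proposition3p1:
  shows "(\<forall>p\<in>Irr_diff1. \<forall>q\<in>Irr_diff1. tensor_defined (scalar_pmod p) (scalar_pmod q))
    \<and> comm_group Irr_diff1_group
    \<and> lie_group TYPE(real^3) Irr_diff1_group
    \<and> \<one>\<^bsub>Irr_diff1_group\<^esub> = (of_real (1 / sqrt 2), of_real (1 / sqrt 2))
    \<and> (\<forall>\<alpha> :: complex \<Rightarrow> real. (\<forall>z. z \<noteq> 0 \<longrightarrow> is_Arg z (\<alpha> z)) \<longrightarrow>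
         (\<forall>(a, b)\<in>Irr_diff1. inv\<^bsub>Irr_diff1_group\<^esub> (a, b) =
            (of_real (cmod b) * exp (- \<i> * of_real (\<alpha> a)),
             of_real (cmod a) * exp (- \<i> * of_real (\<alpha> b)))))
    \<and> lie_group TYPE(real^3) (circle_group \<times>\<times> (circle_group \<times>\<times> real_add_group))
    \<and> lie_group_iso (circle_group \<times>\<times> (circle_group \<times>\<times> real_add_group)) Irr_diff1_group
        (\<lambda>(u, v, t). (u / of_real (sqrt (exp t + 1)), of_real (sqrt (exp t / (exp t + 1))) * v))
    \<and> connected (carrier Irr_diff1_group)"
proof (intro conjI)
  have carrier: "carrier Irr_diff1_group = Irr_diff1" by (simp add: Irr_diff1_group_def)
  have diff: "diffeomorphism (carrier param_group) (carrier Irr_diff1_group) param coords"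
    unfolding carrier by (rule diffeomorphism_param)
  have "lie_group TYPE(real \<times> real \<times> real) param_group"
    by (intro lie_group_DirProd lie_group_circle lie_group_real_add)
  then show param_group: "lie_group TYPE(real^3) param_group"
    by (rule lie_group_model) simp
  show "comm_group Irr_diff1_group" by (rule comm_group_Irr_diff1)
  then have "group Irr_diff1_group" by (rule comm_group.axioms(2))
  then show "lie_group TYPE(real^3) Irr_diff1_group"
    by (rule lie_group_transfer[OF param_group _ param_iso diff])
  show "lie_group_iso param_group Irr_diff1_group
      (\<lambda>(u, v, t). (u / of_real (sqrt (exp t + 1)), of_real (sqrt (exp t / (exp t + 1))) * v))"
    unfolding lie_group_iso_def param_def[symmetric] using param_iso diff by blast
  show "\<forall>p\<in>Irr_diff1. \<forall>q\<in>Irr_diff1. tensor_defined (scalar_pmod p) (scalar_pmod q)"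
    by (auto simp: Irr_diff1_def tensor_defined_scalar)
  show "\<one>\<^bsub>Irr_diff1_group\<^esub> = (of_real (1 / sqrt 2), of_real (1 / sqrt 2))"
    by (simp add: Irr_diff1_group_def)
  show "\<forall>\<alpha> :: complex \<Rightarrow> real. (\<forall>z. z \<noteq> 0 \<longrightarrow> is_Arg z (\<alpha> z)) \<longrightarrow>
         (\<forall>(a, b)\<in>Irr_diff1. inv\<^bsub>Irr_diff1_group\<^esub> (a, b) =
            (of_real (cmod b) * exp (- \<i> * of_real (\<alpha> a)),
             of_real (cmod a) * exp (- \<i> * of_real (\<alpha> b))))"
    using inv_Irr_diff1 by (fastforce simp: Irr_diff1_def)
  show "connected (carrier Irr_diff1_group)"
    unfolding carrier by (rule connected_Irr_diff1)
qed

end
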